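(* For every integer $r>0$, both of the following identities hold: $$\sum_{n=1}^{\infty}\frac{1}{4^n\alpha^{rn}L^n_r}\binom{2n}{n}(H_{2n}-H_n)=-\frac{\sqrt{\alpha^rL_r}}{\sqrt{\alpha^r L_r-1}}\ln \left(\frac{\sqrt{\alpha^rL_r}+\sqrt{\alpha^r L_r-1}}{2\sqrt{\alpha^r L_r}}\right),$$ $$\sum_{n=1}^{\infty}\frac{1}{(4\sqrt{5})^n\alpha^{rn}F^n_r}\binom{2n}{n}(H_{2n}-H_n)=-\frac{\sqrt{\alpha^rF_r\sqrt{5}}}{\sqrt{\alpha^r F_r \sqrt{5}-1}}\ln\left(\frac{\sqrt{\alpha^rF_r\sqrt{5}}+\sqrt{\alpha^rF_r\sqrt{5}-1}}{2\sqrt{\alpha^rF_r\sqrt{5}}}\right).$$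
   Context: $H_n=\sum_{k=1}^n \frac1k$ is the $n$-th harmonic number. $\alpha=\frac{1+\sqrt5}{2}$ is the golden ratio. $F_n$ and $L_n$ are the Fibonacci and Lucas numbers: both satisfy $\Gamma_n=\Gamma_{n-1}+\Gamma_{n-2}$ for $n\ge2$, with $F_0=0$, $F_1=1$ and $L_0=2$, $L_1=1$. $L_r^n$ and $F_r^n$ mean $(L_r)^n$ and $(F_r)^n$. *)

theory Defs
  imports "HOL-Number_Theory.Fib" "HOL-Analysis.Harmonic_Numbers"
begin

definition golden_ratio :: real where
  "golden_ratio = (1 + sqrt 5) / 2"

fun lucas :: "nat \<Rightarrow> nat" where
  "lucas 0 = 2"
| "lucas (Suc 0) = 1"
| "lucas (Suc (Suc n)) = lucas (Suc n) + lucas n"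

end

theory Submission
  imports Defs "HOL-Analysis.Generalised_Binomial_Theorem"
begin

text \<open>
  Both identities are values of one generating function: for \<open>\<bar>x\<bar> < 1\<close>,
  \[ \sum_{n \ge 0} 4^{-n} {2n \choose n} (H_{2n} - H_n) x^n
     = - \frac{1}{\sqrt{1-x}} \ln \frac{1 + \sqrt{1-x}}{2}, \]
  taken at \<open>x = 1/A\<close> with \<open>A = \<alpha>\<^sup>r L\<^sub>r\<close> and \<open>A = \<alpha>\<^sup>r F\<^sub>r \<surd>5\<close>. All that matters about
  the Fibonacci and Lucas numbers is that they are positive, which together with \<open>\<alpha> > 1\<close> gives
  \<open>A > 1\<close> and puts \<open>x\<close> inside the disc of convergence.

  The generating function comes from a differential equation. Write \<open>c\<^sub>n\<close>
  for the central binomial coefficient divided by \<open>4\<^sup>n\<close> and \<open>a\<^sub>n = c\<^sub>n (H\<^sub>2\<^sub>n - H\<^sub>n)\<close>. The ratio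
  \<open>c\<^sub>n\<^sub>+\<^sub>1 / c\<^sub>n = (2n+1)/(2n+2)\<close> and the increment \<open>1/((2n+1)(2n+2))\<close> of \<open>H\<^sub>2\<^sub>n - H\<^sub>n\<close> combine to
  \<open>(2n+2) a\<^sub>n\<^sub>+\<^sub>1 = (2n+1) a\<^sub>n + c\<^sub>n/(2n+2)\<close>
  (lemma \<open>central_harm_rec\<close>), so \<open>f(x) = \<Sum> a\<^sub>n x\<^sup>n\<close> satisfies
  \<open>2 (1-x) f' - f = g\<close> with \<open>g(x) = \<Sum> c\<^sub>n x\<^sup>n / (2n+2)\<close>. Up to sign and a shift, \<open>g\<close> is the
  binomial series of \<open>s = \<surd>(1-x)\<close> without its constant term, and therefore \<open>g = 1/(1+s)\<close>
  (lemma \<open>central_binom_integrated_sums\<close>). Since \<open>s\<close> is an integrating factor,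
  \<open>(s f)' = g/(2s) = 1/(2s(1+s))\<close>, which is also the derivative of \<open>- ln ((1+s)/2)\<close>; both functions vanish at \<open>0\<close>.
\<close>

section \<open>The coefficients and their recurrence\<close>

definition central :: "nat \<Rightarrow> real" where
  "central n = real ((2 * n) choose n) / 4 ^ n"

definition central_harm :: "nat \<Rightarrow> real" where
  "central_harm n = central n * (harm (2 * n) - harm n)"

lemma central_0 [simp]: "central 0 = 1"
  by (simp add: central_def)

lemma central_harm_0 [simp]: "central_harm 0 = 0"
  by (simp add: central_harm_def)

lemma central_Suc: "central (Suc n) = central n * (2 * real n + 1) / (2 * real n + 2)"
proof -
  have binom: "real ((2 * m) choose m) = fact (2 * m) / (fact m)\<^sup>2" for m
    using binomial_fact[of m "2 * m", where 'a = real]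
    by (simp add: power2_eq_square flip: mult_2)
  have "fact (2 * Suc n) = (2 * real n + 2) * ((2 * real n + 1) * fact (2 * n))"
  proof -
    have "2 * Suc n = Suc (Suc (2 * n))" by simp
    then show ?thesis by (simp only: fact_Suc) (simp add: add_ac)
  qed
  moreover have "fact (Suc n) = (real n + 1) * fact n"
    by (simp add: add_ac)
  ultimately have "real ((2 * Suc n) choose Suc n)
      = ((2 * real n + 2) * (2 * real n + 1) / (real n + 1)\<^sup>2) * real ((2 * n) choose n)"
    unfolding binom by (simp only: power_mult_distrib times_divide_times_eq mult.assoc)
  moreover have "(2 * real n + 2) * (2 * real n + 1) / (real n + 1)\<^sup>2
      = 4 * ((2 * real n + 1) / (2 * real n + 2))"
    by (simp add: divide_simps power2_eq_square) (simp add: algebra_simps)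
  ultimately have "real ((2 * Suc n) choose Suc n)
      = 4 * ((2 * real n + 1) / (2 * real n + 2)) * real ((2 * n) choose n)"
    by (simp only:)
  moreover have "4 * q * b / 4 ^ Suc n = b / 4 ^ n * q" for q b :: real
    by simp
  ultimately have "central (Suc n) = central n * ((2 * real n + 1) / (2 * real n + 2))"
    unfolding central_def by (simp only:)
  then show ?thesis by simp
qed

lemma central_nonneg: "central n \<ge> 0"
  by (simp add: central_def)

lemma central_le_1: "central n \<le> 1"
proof (induction n)
  case (Suc n)
  have "central (Suc n) = central n * ((2 * real n + 1) / (2 * real n + 2))"
    by (simp add: central_Suc)
  also have "\<dots> \<le> 1 * 1"
    by (intro mult_mono Suc) (auto simp: central_nonneg)
  finally show ?case by simp
qed simp

lemma harm_double_diff_Suc: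
  "harm (2 * Suc n) - harm (Suc n)
     = harm (2 * n) - harm n + 1 / ((2 * real n + 1) * (2 * real n + 2))"
proof -
  have "harm (2 * Suc n) = harm (2 * n) + 1 / (2 * real n + 1) + (1 / (2 * real n + 2) :: real)"
    by (simp add: harm_Suc inverse_eq_divide add_ac)
  moreover have "harm (Suc n) = harm n + (1 / (real n + 1) :: real)"
    by (simp add: harm_Suc inverse_eq_divide add_ac)
  moreover have "1 / (2 * real n + 1) + 1 / (2 * real n + 2) - 1 / (real n + 1)
      = 1 / ((2 * real n + 1) * (2 * real n + 2))"
  proof -
    have "2 * real n + 1 \<noteq> 0" "real n + 1 \<noteq> 0" by linarith+
    moreover have "2 * real n + 2 = 2 * (real n + 1)" by simp
    ultimately show ?thesis
      by (simp add: divide_simps) (simp add: algebra_simps)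
  qed
  ultimately show ?thesis by linarith
qed

text \<open>
  The difference \<open>H\<^sub>2\<^sub>n - H\<^sub>n\<close> consists of \<open>n\<close> summands, each at most \<open>1/(n+1)\<close>; the bound by \<open>1\<close>
  would be enough to compare the series with a geometric one, but it is not inductive, because
  \<open>H\<^sub>2\<^sub>n - H\<^sub>n\<close> increases. The bound \<open>n/(n+1)\<close> is: its increment \<open>1/((n+1)(n+2))\<close> dominates the
  increment \<open>1/((2n+1)(2n+2))\<close> of the difference.
\<close>

lemma harm_double_diff_bounds:
  "harm (2 * n) - harm n \<in> {0..real n / (real n + 1)}"
proof (induction n)
  case (Suc n)
  have "1 / ((2 * real n + 1) * (2 * real n + 2)) \<le> 1 / ((real n + 1) * (real n + 2))"
    by (intro frac_le mult_mono) auto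
  also have "\<dots> = real (Suc n) / (real (Suc n) + 1) - real n / (real n + 1)"
    by (simp add: divide_simps) (simp add: algebra_simps)
  finally show ?case
    using Suc unfolding harm_double_diff_Suc by auto
qed simp

lemma abs_central_harm_le_1: "\<bar>central_harm n\<bar> \<le> 1"
proof -
  have "harm (2 * n) - harm n \<le> (1 :: real)"
    using harm_double_diff_bounds[of n] by (auto intro: order_trans)
  then have "central n * (harm (2 * n) - harm n) \<le> 1 * 1"
    using harm_double_diff_bounds[of n]
    by (intro mult_mono central_le_1) auto
  then show ?thesis
    using harm_double_diff_bounds[of n] central_nonneg[of n]
    by (simp add: central_harm_def)
qed

lemma central_harm_rec:
  "(2 * real n + 2) * central_harm (Suc n)
     = (2 * real n + 1) * central_harm n + central n / (2 * real n + 2)"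
proof -
  define h :: real where "h = harm (2 * n) - harm n"
  define u where "u = 2 * real n + 1"
  define v where "v = 2 * real n + 2"
  have nz: "u \<noteq> 0" "v \<noteq> 0" unfolding u_def v_def by linarith+
  have "v * central_harm (Suc n) = v * (central n * u / v * (h + 1 / (u * v)))"
    unfolding central_harm_def harm_double_diff_Suc central_Suc by (simp add: h_def u_def v_def)
  also have "\<dots> = u * (central n * h) + central n / v"
    using nz by (simp add: distrib_left)
  finally show ?thesis
    by (simp add: u_def v_def h_def central_harm_def)
qed

section \<open>The generating function\<close>

lemma summable_bounded_powser:
  fixes a :: "nat \<Rightarrow> real"
  assumes "\<And>n. \<bar>a n\<bar> \<le> 1" "\<bar>x\<bar> < 1"
  shows "summable (\<lambda>n. a n * x ^ n)"
proof (rule summable_comparison_test')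
  show "summable (\<lambda>n. \<bar>x\<bar> ^ n)" using assms(2) by (simp add: summable_geometric)
  show "norm (a n * x ^ n) \<le> \<bar>x\<bar> ^ n" if "n \<ge> 0" for n
    using mult_right_mono[OF assms(1)[of n], of "\<bar>x\<bar> ^ n"] by (simp add: abs_mult power_abs)
qed

lemma half_gbinomial_eq_central:
  "((1 / 2 :: real) gchoose Suc n) * (- 1) ^ Suc n = - central n / (2 * real n + 2)"
proof (induction n)
  case (Suc n)
  have rec: "((1 / 2 :: real) gchoose Suc (Suc n))
      = ((1 / 2) gchoose Suc n) * (1 / 2 - (real n + 1)) / (real n + 2)"
    using gbinomial_mult_1[of "1 / 2 :: real" "Suc n"] by (simp add: field_simps)
  have "((1 / 2 :: real) gchoose Suc (Suc n)) * (- 1) ^ Suc (Suc n)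
      = ((1 / 2) gchoose Suc n) * (- 1) ^ Suc n * ((2 * real n + 1) / (2 * (real n + 2)))"
    unfolding rec by (simp add: field_simps)
  also have "\<dots> = - central (Suc n) / (2 * real (Suc n) + 2)"
    unfolding Suc central_Suc by (simp add: field_simps)
  finally show ?case .
qed simp

text \<open>
  The binomial series of \<open>\<surd>(1-x)\<close> without its constant term is \<open>- x\<close> times the series below, so
  the sum is \<open>(1 - \<surd>(1-x)) / x\<close>. The form \<open>1 / (1 + \<surd>(1-x))\<close> also covers \<open>x = 0\<close>.
\<close>

lemma central_binom_integrated_sums:
  assumes "\<bar>x\<bar> < 1"
  shows "(\<lambda>n. central n / (2 * real n + 2) * x ^ n) sums (1 / (1 + sqrt (1 - x)))"
proof (cases "x = 0")
  case True
  then show ?thesis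
    using powser_sums_zero[of "\<lambda>n. central n / (2 * real n + 2)"] by simp
next
  case False
  have "(\<lambda>n. ((1 / 2 :: real) gchoose n) * (- x) ^ n) sums (1 + - x) powr (1 / 2)"
    using assms by (intro gen_binomial_real) auto
  then have "(\<lambda>n. ((1 / 2 :: real) gchoose Suc n) * (- x) ^ Suc n) sums (sqrt (1 - x) - 1)"
    using assms by (subst sums_Suc_iff) (simp add: powr_half_sqrt)
  moreover have "((1 / 2 :: real) gchoose Suc n) * (- x) ^ Suc n
      = - x * (central n / (2 * real n + 2) * x ^ n)" for n
  proof -
    have "((1 / 2 :: real) gchoose Suc n) * (- x) ^ Suc n
        = (((1 / 2) gchoose Suc n) * (- 1) ^ Suc n) * x ^ Suc n"
      by (simp only: power_minus[of x] mult.assoc)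
    also have "\<dots> = - x * (central n / (2 * real n + 2) * x ^ n)"
      unfolding half_gbinomial_eq_central by simp
    finally show ?thesis .
  qed
  ultimately have "(\<lambda>n. - x * (central n / (2 * real n + 2) * x ^ n)) sums (sqrt (1 - x) - 1)"
    by simp
  from sums_mult[OF this, of "- 1 / x"] False
  have "(\<lambda>n. central n / (2 * real n + 2) * x ^ n) sums (- 1 / x * (sqrt (1 - x) - 1))"
    by simp
  moreover have "- 1 / x * (sqrt (1 - x) - 1) = 1 / (1 + sqrt (1 - x))"
  proof -
    have "(1 - sqrt (1 - x)) * (1 + sqrt (1 - x)) = x"
      using assms by (simp add: algebra_simps flip: power2_eq_square)
    moreover have "1 + sqrt (1 - x) > 0" using assms by (simp add: add_pos_nonneg)
    ultimately show ?thesis using False by (simp add: field_simps)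
  qed
  ultimately show ?thesis by simp
qed

text \<open>
  Multiplying the recurrence for the coefficients by \<open>x\<^sup>n\<close> and summing turns it into a linear
  first-order differential equation for the generating function.
\<close>

lemma central_harm_powser_ode:
  assumes "\<bar>x\<bar> < 1"
  obtains D where "((\<lambda>x. \<Sum>n. central_harm n * x ^ n) has_real_derivative D) (at x)"
    and "2 * (1 - x) * D = (\<Sum>n. central_harm n * x ^ n) + 1 / (1 + sqrt (1 - x))"
proof -
  define D where "D = (\<Sum>n. diffs central_harm n * x ^ n)"
  have summable: "summable (\<lambda>n. central_harm n * y ^ n)" if "\<bar>y\<bar> < 1" for y
    using that abs_central_harm_le_1 by (intro summable_bounded_powser)
  have deriv: "((\<lambda>x. \<Sum>n. central_harm n * x ^ n) has_real_derivative D) (at x)"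
    unfolding D_def using assms by (intro termdiffs_strong'[where K = 1] summable) auto
  have sums_D: "(\<lambda>n. diffs central_harm n * x ^ n) sums D"
    unfolding D_def using assms by (intro summable_sums termdiff_converges[where K = 1] summable) auto
  have sums_xD: "(\<lambda>n. real n * central_harm n * x ^ n) sums (x * D)"
  proof -
    have "(\<lambda>n. real (Suc n) * central_harm (Suc n) * x ^ Suc n) sums (x * D)"
      using sums_mult[OF sums_D, of x] by (simp add: diffs_def mult_ac)
    then show ?thesis
      by (subst (asm) sums_Suc_iff) simp
  qed
  have sums_f: "(\<lambda>n. central_harm n * x ^ n) sums (\<Sum>n. central_harm n * x ^ n)"
    using summable assms by (intro summable_sums) auto
  have "(\<lambda>n. 2 * (real n * central_harm n * x ^ n) + central_harm n * x ^ n
            + central n / (2 * real n + 2) * x ^ n)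
      sums (2 * (x * D) + (\<Sum>n. central_harm n * x ^ n) + 1 / (1 + sqrt (1 - x)))"
    by (intro sums_add sums_mult sums_xD sums_f central_binom_integrated_sums assms)
  moreover have "2 * (real n * central_harm n * x ^ n) + central_harm n * x ^ n
            + central n / (2 * real n + 2) * x ^ n = 2 * (diffs central_harm n * x ^ n)" for n
  proof -
    have "2 * (diffs central_harm n * x ^ n) = (2 * real n + 2) * central_harm (Suc n) * x ^ n"
      by (simp add: diffs_def algebra_simps)
    then show ?thesis
      unfolding central_harm_rec by (simp add: algebra_simps)
  qed
  ultimately have "2 * (x * D) + (\<Sum>n. central_harm n * x ^ n) + 1 / (1 + sqrt (1 - x)) = 2 * D"
    using sums_mult[OF sums_D, of 2] by (auto dest: sums_unique2)
  then have "2 * (1 - x) * D = (\<Sum>n. central_harm n * x ^ n) + 1 / (1 + sqrt (1 - x))"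
    by (simp add: algebra_simps)
  with deriv show ?thesis by (rule that)
qed

text \<open>
  The factor \<open>\<surd>(1-x)\<close> integrates the differential equation, so the product of the generating
  function with it differs from \<open>- ln ((1 + \<surd>(1-x)) / 2)\<close> by a constant, which is \<open>0\<close> at the origin.
\<close>

lemma central_harm_sums:
  assumes "\<bar>x\<bar> < 1"
  shows "(\<lambda>n. central_harm n * x ^ n) sums (- ln ((1 + sqrt (1 - x)) / 2) / sqrt (1 - x))"
proof -
  define f where "f = (\<lambda>x. \<Sum>n. central_harm n * x ^ n)"
  define G where "G = (\<lambda>x. sqrt (1 - x) * f x + ln ((1 + sqrt (1 - x)) / 2))"
  have deriv: "(G has_real_derivative 0) (at y)" if y: "\<bar>y\<bar> < 1" for y
  proof -
    have f_y: "f y = (\<Sum>n. central_harm n * y ^ n)" by (simp add: f_def)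
    obtain D where D: "(f has_real_derivative D) (at y)"
      and ode: "2 * (1 - y) * D = f y + 1 / (1 + sqrt (1 - y))"
      by (rule central_harm_powser_ode[OF y, folded f_def f_y])
    define s where "s = sqrt (1 - y)"
    have s: "s > 0" "s\<^sup>2 = 1 - y" using y by (simp_all add: s_def)
    have "1 + sqrt (1 - y) \<noteq> 0"
      using s(1) unfolding s_def by linarith
    then have "(G has_real_derivative
        (- (inverse s / 2) * f y + D * s + - (inverse s / 2) / 2 / ((1 + s) / 2))) (at y)"
      unfolding G_def s_def using y
      by (auto intro!: derivative_eq_intros D add_pos_nonneg simp: divide_simps)
    moreover have "- (inverse s / 2) * f y + D * s + - (inverse s / 2) / 2 / ((1 + s) / 2) = 0"
    proof -
      have "- (inverse s / 2) * f y + D * s + - (inverse s / 2) / 2 / ((1 + s) / 2)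
          = (2 * s\<^sup>2 * D - f y - 1 / (1 + s)) / (2 * s)"
        using s(1) by (simp add: divide_simps power2_eq_square)
      also have "\<dots> = 0"
        using ode unfolding s(2) by (simp flip: s_def)
      finally show ?thesis .
    qed
    ultimately show ?thesis by simp
  qed
  have "\<exists>c. \<forall>y\<in>{- 1 <..< 1}. G y = c"
    by (rule has_field_derivative_zero_constant)
       (use deriv in \<open>auto intro: has_field_derivative_at_within\<close>)
  then have "G x = G 0" using assms by fastforce
  also have "G 0 = 0" by (simp add: G_def f_def)
  finally have "f x = - ln ((1 + sqrt (1 - x)) / 2) / sqrt (1 - x)"
    using assms by (simp add: G_def field_simps)
  moreover have "summable (\<lambda>n. central_harm n * x ^ n)"
    by (intro summable_bounded_powser abs_central_harm_le_1 assms)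
  then have "(\<lambda>n. central_harm n * x ^ n) sums f x"
    unfolding f_def by (rule summable_sums)
  ultimately show ?thesis by simp
qed

section \<open>Fibonacci and Lucas arguments\<close>

lemma central_binom_harm_sums_inverse:
  assumes "A > 1"
  shows "(\<lambda>k. real ((2 * (k + 1)) choose (k + 1)) * (harm (2 * (k + 1)) - harm (k + 1)) / (4 * A) ^ (k + 1))
    sums (- (sqrt A / sqrt (A - 1)) * ln ((sqrt A + sqrt (A - 1)) / (2 * sqrt A)))"
proof -
  have "(\<lambda>n. central_harm n * (1 / A) ^ n)
      sums (- ln ((1 + sqrt (1 - 1 / A)) / 2) / sqrt (1 - 1 / A))"
    using assms by (intro central_harm_sums) auto
  then have "(\<lambda>k. central_harm (k + 1) * (1 / A) ^ (k + 1))
      sums (- ln ((1 + sqrt (1 - 1 / A)) / 2) / sqrt (1 - 1 / A))"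
    unfolding Suc_eq_plus1[symmetric] by (subst sums_Suc_iff) simp
  moreover have "- ln ((1 + sqrt (1 - 1 / A)) / 2) / sqrt (1 - 1 / A)
      = - (sqrt A / sqrt (A - 1)) * ln ((sqrt A + sqrt (A - 1)) / (2 * sqrt A))"
  proof -
    have root: "sqrt (1 - 1 / A) = sqrt (A - 1) / sqrt A"
      using assms by (simp add: field_simps flip: real_sqrt_divide)
    have half: "(1 + sqrt (A - 1) / sqrt A) / 2 = (sqrt A + sqrt (A - 1)) / (2 * sqrt A)"
      using assms by (simp add: divide_simps)
    show ?thesis unfolding root half by simp
  qed
  moreover have "central_harm n * (1 / A) ^ n
      = real ((2 * n) choose n) * (harm (2 * n) - harm n) / (4 * A) ^ n" for n
    by (simp add: central_harm_def central_def power_mult_distrib power_divide)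
  ultimately show ?thesis by (simp only:)
qed

lemma lucas_pos: "lucas n > 0"
  by (induction n rule: lucas.induct) auto

lemma golden_ratio_power_gt_1:
  assumes "r > 0"
  shows "golden_ratio ^ r > 1"
proof -
  have "golden_ratio > 1" by (simp add: golden_ratio_def)
  with assms show ?thesis by (rule one_less_power[rotated])
qed

theorem theorem2p2:
  fixes r :: nat
  assumes "r > 0"
  shows "(\<lambda>k. let n = k + 1 in
            1 / (4 ^ n * golden_ratio ^ (r * n) * real (lucas r) ^ n)
              * real ((2 * n) choose n) * (harm (2 * n) - harm n))
      sums
      (- (sqrt (golden_ratio ^ r * real (lucas r)) / sqrt (golden_ratio ^ r * real (lucas r) - 1))
         * ln ((sqrt (golden_ratio ^ r * real (lucas r)) + sqrt (golden_ratio ^ r * real (lucas r) - 1))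
               / (2 * sqrt (golden_ratio ^ r * real (lucas r)))))
    \<and> (\<lambda>k. let n = k + 1 in
            1 / ((4 * sqrt 5) ^ n * golden_ratio ^ (r * n) * real (fib r) ^ n)
              * real ((2 * n) choose n) * (harm (2 * n) - harm n))
      sums
      (- (sqrt (golden_ratio ^ r * real (fib r) * sqrt 5) / sqrt (golden_ratio ^ r * real (fib r) * sqrt 5 - 1))
         * ln ((sqrt (golden_ratio ^ r * real (fib r) * sqrt 5) + sqrt (golden_ratio ^ r * real (fib r) * sqrt 5 - 1))
               / (2 * sqrt (golden_ratio ^ r * real (fib r) * sqrt 5))))"
proof -
  have mult_gt_1: "a * b > 1" if "a > 1" "b \<ge> 1" for a b :: real
    using mult_strict_mono'[of 1 a 1 b] mult_left_mono[of 1 b a] that by linarith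
  have lucas: "golden_ratio ^ r * real (lucas r) > 1"
    using golden_ratio_power_gt_1[OF assms] lucas_pos[of r] by (intro mult_gt_1) auto
  have fib: "golden_ratio ^ r * real (fib r) * sqrt 5 > 1"
    using golden_ratio_power_gt_1[OF assms] fib_neq_0_nat[OF assms] by (intro mult_gt_1) auto
  have lucas_term: "1 / (4 ^ n * golden_ratio ^ (r * n) * real (lucas r) ^ n) * B * h
      = B * h / (4 * (golden_ratio ^ r * real (lucas r))) ^ n" for n B h
    unfolding power_mult by (simp add: power_mult_distrib)
  have fib_term: "1 / ((4 * sqrt 5) ^ n * golden_ratio ^ (r * n) * real (fib r) ^ n) * B * h
      = B * h / (4 * (golden_ratio ^ r * real (fib r) * sqrt 5)) ^ n" for n B h
    unfolding power_mult by (simp add: power_mult_distrib)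
  show ?thesis
    unfolding Let_def lucas_term fib_term
    by (intro conjI central_binom_harm_sums_inverse lucas fib)
qed

end
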